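(* Let $(V,h)$ be a metric vector space of dimension $n>3$. If $h$ has indefinite signature with minimal inertial index $k\ge1$, then $(\mathcal{MC}_W(V^* ),\ast)$ is spanned by square-zero elements and contains a trivial subalgebra of dimension $n-2k-1$.
   Context: All vector spaces are finite-dimensional over $\mathbb{R}$. A metric vector space $(V,h)$ has a nondegenerate symmetric bilinear form $h_{ij}$; indices are raised and lowered with $h$; brackets around indices denote complete antisymmetrization, normalized to be a projection. If $h$ has signature $(p,q)$, its minimal inertial index is $\min\{p,q\}$. $\mathcal{MC}(V^* )=\{Y_{ijkl}\in\otimes^4V^*: Y_{[ij]kl}=Y_{ijkl}=Y_{ij[kl]},\ Y_{[ijk]l}=0\}$; $\rho(Y)_{ij}=Y_{pij}{}^p$; $\mathcal{MC}_W(V^* )=\ker\rho$. For $X\in\mathcal{MC}(V^* )$, $\widehat X\in\operatorname{End}(\otimes^mV^* )$ is $\widehat X(\alpha)_{i_1\dots i_m}=\tfrac1m\sum_{r\ne s}X^{p}{}_{i_ri_s}{}^{q}\,\alpha_{i_1\dots p\dots q\dots i_m}$, the sum running over ordered pairs $(r,s)$ of distinct positions, with $p$ in position $r$ and $q$ in position $s$. The commutative multiplication on $\mathcal{MC}(V^* )$ is $X\ast Y:=\widehat X(Y)$; $\mathcal{MC}_W(V^* )$ is closed under it. An element $X$ is square-zero if $X\ast X=0$. A trivial subalgebra is a subspace on which all products vanish. *)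

theory Defs
  imports
    "HOL-Analysis.Analysis"
    "HOL-Combinatorics.Permutations"
    "HOL-Library.Function_Algebras"
begin

text \<open>Tensors are real-valued functions, so we put the pointwise vector space structure on function
  types; this makes \<^term>\<open>span\<close>, \<^term>\<open>subspace\<close> and \<^term>\<open>dim\<close> available for spaces of tensors.\<close>

instantiation "fun" :: (type, real_vector) real_vector
begin

definition scaleR_fun_def: "c *\<^sub>R f = (\<lambda>x. c *\<^sub>R f x)"

instance
  by standard (auto simp: scaleR_fun_def fun_eq_iff algebra_simps)

end


section \<open>Metric vector spaces\<close>

definition metric_vector_space :: "('v::real_vector \<Rightarrow> 'v \<Rightarrow> real) \<Rightarrow> bool" where
  "metric_vector_space h \<longleftrightarrow>
     (\<exists>B::'v set. finite B \<and> span B = UNIV) \<and>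
     bilinear h \<and> (\<forall>x y. h x y = h y x) \<and> (\<forall>x. (\<forall>y. h x y = 0) \<longrightarrow> x = 0)"

definition has_signature :: "('v::real_vector \<Rightarrow> 'v \<Rightarrow> real) \<Rightarrow> nat \<Rightarrow> nat \<Rightarrow> bool" where
  "has_signature h p q \<longleftrightarrow>
     (\<exists>B. finite B \<and> independent B \<and> span B = UNIV \<and>
          (\<forall>b\<in>B. \<forall>c\<in>B. b \<noteq> c \<longrightarrow> h b c = 0) \<and>
          (\<forall>b\<in>B. h b b = 1 \<or> h b b = -1) \<and>
          card {b\<in>B. h b b = 1} = p \<and> card {b\<in>B. h b b = -1} = q)"

definition dual_vec :: "('v::real_vector \<Rightarrow> 'v \<Rightarrow> real) \<Rightarrow> 'v set \<Rightarrow> 'v \<Rightarrow> 'v" where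
  "dual_vec h B b = (THE v. \<forall>c\<in>B. h v c = (if c = b then 1 else 0))"

text \<open>The metric contraction \<open>F\<^sub>p\<^sup>p = h\<^sup>p\<^sup>q F\<^sub>p\<^sub>q\<close> of a bilinear \<open>F\<close>: the vectors
  \<open>dual_vec h B b\<close> are the \<open>b\<close>'s with index raised. The choice of basis is immaterial by
  \<open>metric_trace_basis\<close> below. Its arguments may be named \<open>p\<close> and \<open>p'\<close> for the lower and the
  upper occurrence of the contracted index; which is which does not matter, \<open>h\<close> being symmetric.\<close>

definition metric_trace :: "('v::real_vector \<Rightarrow> 'v \<Rightarrow> real) \<Rightarrow> ('v \<Rightarrow> 'v \<Rightarrow> real) \<Rightarrow> real" where
  "metric_trace h F = (\<Sum>b\<in>extend_basis {}. F b (dual_vec h (extend_basis {}) b))"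

lemma
  fixes h :: "'v::real_vector \<Rightarrow> 'v \<Rightarrow> real"
  assumes h: "metric_vector_space h" and B: "independent B" "span B = UNIV"
  shows finite_basis: "finite B"
    and dual_vec: "b \<in> B \<Longrightarrow> c \<in> B \<Longrightarrow> h (dual_vec h B b) c = (if c = b then 1 else 0)"
    and sum_dual_vec: "(\<Sum>b\<in>B. h u b *\<^sub>R dual_vec h B b) = u"
    and sum_dual_vec': "(\<Sum>b\<in>B. h (dual_vec h B b) u *\<^sub>R b) = u"
proof -
  obtain B0 :: "'v set" where B0: "finite B0" "span B0 = UNIV"
    using h unfolding metric_vector_space_def by blast
  show fin: "finite B"
    using independent_span_bound[OF B0(1) B(1)] B0(2) by auto
  interpret fd: finite_dimensional_vector_space "scaleR :: real \<Rightarrow> 'v \<Rightarrow> 'v" B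
    using B fin by unfold_locales (auto simp: dependent_raw_def span_raw_def)
  have bil: "bilinear h" and sym: "\<And>x y. h x y = h y x"
    and nd: "\<And>x. (\<And>y. h x y = 0) \<Longrightarrow> x = 0"
    using h unfolding metric_vector_space_def by auto
  have lin: "linear (\<lambda>y. h x y)" "linear (\<lambda>y. h y x)" for x
    using bil unfolding bilinear_def by auto
  have nd': "x = y" if "\<And>c. c \<in> B \<Longrightarrow> h x c = h y c" for x y
  proof -
    have "h (x - y) z = 0" for z
    proof -
      have "h x z = h y z"
        by (rule linear_eq_on_span[OF lin(1) lin(1), of B]) (use that B(2) in auto)
      then show ?thesis by (simp add: linear_diff[OF lin(2)])
    qed
    from nd[OF this] show ?thesis by simp
  qed
  define T where "T v = (\<Sum>b\<in>B. h v b *\<^sub>R b)" for v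
  have linT: "linear T"
    unfolding T_def
    by (rule linearI) (simp_all add: linear_add[OF lin(2)] linear_cmul[OF lin(2)] scaleR_add_left
        sum.distrib scaleR_right.sum scaleR_sum_right)
  have coeff: "f = g" if "(\<Sum>b\<in>B. f b *\<^sub>R b) = (\<Sum>b\<in>B. g b *\<^sub>R b)"
      "\<And>b. b \<notin> B \<Longrightarrow> f b = g b" for f g
  proof -
    have "(\<Sum>b\<in>B. (f b - g b) *\<^sub>R b) = 0"
      using that(1) by (simp add: scaleR_left_diff_distrib sum_subtractf)
    then have eq: "f b - g b = 0" if "b \<in> B" for b
      by (rule independentD[OF B(1) fin subset_refl _ that])
    show ?thesis
    proof
      fix b show "f b = g b"
        using eq[of b] that(2)[of b] by (cases "b \<in> B") simp_all
    qed
  qed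
  have "inj T"
  proof (rule injI)
    fix x y assume "T x = T y"
    then have "(\<lambda>b. if b \<in> B then h x b else 0) = (\<lambda>b. if b \<in> B then h y b else 0)"
      unfolding T_def by (intro coeff) (auto simp: fin intro!: sum.cong cong: sum.cong)
    then show "x = y" by (intro nd') (metis (full_types))
  qed
  then have surj: "surj T"
    using linT by (intro fd.linear_inj_imp_surj) (simp_all add: linear_def)
  have dual: "h (dual_vec h B b) c = (if c = b then 1 else 0)" if b: "b \<in> B" and c: "c \<in> B" for b c
  proof -
    obtain v where v: "T v = b" using surj by (metis surjD)
    have "(\<Sum>c\<in>B. (if c = b then 1 else 0) *\<^sub>R c) = b"
      using b fin by (simp add: if_distrib[of "\<lambda>x. x *\<^sub>R _"] sum.delta cong: if_cong)
    with v have "(\<lambda>c. if c \<in> B then h v c else 0) = (\<lambda>c. if c \<in> B \<and> c = b then 1 else 0)"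
      unfolding T_def by (intro coeff) (auto cong: sum.cong)
    then have v': "\<forall>c\<in>B. h v c = (if c = b then 1 else 0)" by (metis (full_types))
    have "\<forall>c\<in>B. h (dual_vec h B b) c = (if c = b then 1 else 0)"
      unfolding dual_vec_def
      by (rule theI[where a = v]) (use v' nd' in auto)
    with c show ?thesis by blast
  qed
  show "b \<in> B \<Longrightarrow> c \<in> B \<Longrightarrow> h (dual_vec h B b) c = (if c = b then 1 else 0)"
    by (rule dual)
  show "(\<Sum>b\<in>B. h u b *\<^sub>R dual_vec h B b) = u"
  proof (rule nd')
    fix c assume c: "c \<in> B"
    have "h (\<Sum>b\<in>B. h u b *\<^sub>R dual_vec h B b) c = (\<Sum>b\<in>B. h u b * h (dual_vec h B b) c)"
      by (simp add: linear_sum[OF lin(2)] linear_cmul[OF lin(2)])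
    also have "\<dots> = (\<Sum>b\<in>B. if c = b then h u b else 0)"
      using c by (intro sum.cong) (auto simp: dual)
    also have "\<dots> = h u c" using c fin by simp
    finally show "h (\<Sum>b\<in>B. h u b *\<^sub>R dual_vec h B b) c = h u c" .
  qed
  have "linear (\<lambda>u. \<Sum>b\<in>B. h (dual_vec h B b) u *\<^sub>R b)"
    by (rule linearI) (simp_all add: linear_add[OF lin(1)] linear_cmul[OF lin(1)] scaleR_add_left
        sum.distrib scaleR_sum_right)
  then show "(\<Sum>b\<in>B. h (dual_vec h B b) u *\<^sub>R b) = u"
  proof (rule linear_eq_on_span[OF _ linear_id[unfolded id_def], of _ B])
    fix c assume c: "c \<in> B"
    have "(\<Sum>b\<in>B. h (dual_vec h B b) c *\<^sub>R b) = (\<Sum>b\<in>B. if b = c then b else 0)"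
      using c by (intro sum.cong) (auto simp: dual)
    then show "(\<Sum>b\<in>B. h (dual_vec h B b) c *\<^sub>R b) = c" using c fin by simp
  qed (use B(2) in auto)
qed

lemma metric_trace_basis:
  fixes h :: "'v::real_vector \<Rightarrow> 'v \<Rightarrow> real"
  assumes h: "metric_vector_space h" and F: "bilinear F"
    and B: "independent B" "span B = UNIV"
  shows "metric_trace h F = (\<Sum>b\<in>B. F b (dual_vec h B b))"
proof -
  define C where "C = extend_basis ({} :: 'v set)"
  have C: "independent C" "span C = UNIV"
    unfolding C_def
    by (simp_all add: real_vector.independent_extend_basis real_vector.span_extend_basis
        real_vector.independent_empty)
  have lin: "linear (\<lambda>y. F x y)" "linear (\<lambda>y. F y x)" for x
    using F unfolding bilinear_def by auto
  have "(\<Sum>c\<in>C. F c (dual_vec h C c)) =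
      (\<Sum>c\<in>C. F (\<Sum>b\<in>B. h (dual_vec h B b) c *\<^sub>R b) (dual_vec h C c))"
    by (simp add: sum_dual_vec'[OF h B])
  also have "\<dots> = (\<Sum>c\<in>C. \<Sum>b\<in>B. h (dual_vec h B b) c * F b (dual_vec h C c))"
    by (simp add: linear_sum[OF lin(2)] linear_cmul[OF lin(2)])
  also have "\<dots> = (\<Sum>b\<in>B. \<Sum>c\<in>C. h (dual_vec h B b) c * F b (dual_vec h C c))"
    by (rule sum.swap)
  also have "\<dots> = (\<Sum>b\<in>B. F b (\<Sum>c\<in>C. h (dual_vec h B b) c *\<^sub>R dual_vec h C c))"
    by (simp add: linear_sum[OF lin(1)] linear_cmul[OF lin(1)])
  also have "\<dots> = (\<Sum>b\<in>B. F b (dual_vec h B b))"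
    by (simp add: sum_dual_vec[OF h C])
  finally show ?thesis unfolding metric_trace_def C_def .
qed


section \<open>Covariant tensors\<close>

text \<open>\<open>\<Otimes>\<^sup>m V\<^sup>*\<close> is the space of \<open>m\<close>-linear forms, taken as functions of the list of their arguments
  (positions counted from \<open>0\<close>). The value on lists of other lengths is fixed to be \<open>0\<close>, so that
  tensors are equal iff they are equal as \<open>m\<close>-linear forms.\<close>

definition tensors :: "nat \<Rightarrow> ('v::real_vector list \<Rightarrow> real) set" where
  "tensors m = {\<alpha>. (\<forall>vs i. length vs = m \<longrightarrow> i < m \<longrightarrow> linear (\<lambda>v. \<alpha> (vs[i := v]))) \<and>
                   (\<forall>vs. length vs \<noteq> m \<longrightarrow> \<alpha> vs = 0)}"

text \<open>Antisymmetrization over the indices in the set \<open>P\<close> of positions.\<close>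

definition antisym :: "nat set \<Rightarrow> ('v list \<Rightarrow> real) \<Rightarrow> 'v list \<Rightarrow> real" where
  "antisym P \<alpha> vs =
     (\<Sum>\<pi> | \<pi> permutes P. of_int (sign \<pi>) * \<alpha> (permute_list \<pi> vs)) / fact (card P)"

definition MC :: "('v::real_vector list \<Rightarrow> real) set" where
  "MC = {Y \<in> tensors 4. antisym {0,1} Y = Y \<and> antisym {2,3} Y = Y \<and> antisym {0,1,2} Y = 0}"

definition \<rho> ::
  "('v::real_vector \<Rightarrow> 'v \<Rightarrow> real) \<Rightarrow> ('v list \<Rightarrow> real) \<Rightarrow> 'v \<Rightarrow> 'v \<Rightarrow> real" where
  "\<rho> h Y x y = metric_trace h (\<lambda>p p'. Y [p, x, y, p'])"

definition MC\<^sub>W :: "('v::real_vector \<Rightarrow> 'v \<Rightarrow> real) \<Rightarrow> ('v list \<Rightarrow> real) set" where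
  "MC\<^sub>W h = {Y \<in> MC. \<rho> h Y = 0}"

text \<open>The endomorphism of \<open>\<Otimes>\<^sup>m V\<^sup>*\<close> induced by \<open>X\<close>, for all \<open>m\<close> at once: \<open>m\<close> is the length of the
  argument list.\<close>

definition hat ::
  "('v::real_vector \<Rightarrow> 'v \<Rightarrow> real) \<Rightarrow> ('v list \<Rightarrow> real) \<Rightarrow> ('v list \<Rightarrow> real) \<Rightarrow> 'v list \<Rightarrow> real" where
  "hat h X \<alpha> vs =
     1 / real (length vs) *
     (\<Sum>(r, s) | r < length vs \<and> s < length vs \<and> r \<noteq> s.
        metric_trace h (\<lambda>p p'. metric_trace h (\<lambda>q q'.
          X [p, vs ! r, vs ! s, q] * \<alpha> (vs[r := p', s := q']))))"

definition mc_mult ::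
  "('v::real_vector \<Rightarrow> 'v \<Rightarrow> real) \<Rightarrow> ('v list \<Rightarrow> real) \<Rightarrow> ('v list \<Rightarrow> real) \<Rightarrow> 'v list \<Rightarrow> real" where
  "mc_mult h X Y = hat h X Y"

definition square_zero :: "('v::real_vector \<Rightarrow> 'v \<Rightarrow> real) \<Rightarrow> ('v list \<Rightarrow> real) \<Rightarrow> bool" where
  "square_zero h X \<longleftrightarrow> mc_mult h X X = 0"

definition trivial_subalgebra ::
  "('v::real_vector \<Rightarrow> 'v \<Rightarrow> real) \<Rightarrow> ('v list \<Rightarrow> real) set \<Rightarrow> bool" where
  "trivial_subalgebra h S \<longleftrightarrow>
     subspace S \<and> S \<subseteq> MC\<^sub>W h \<and> (\<forall>X\<in>S. \<forall>Y\<in>S. mc_mult h X Y = 0)"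

end

theory Submission
  imports Defs
begin

text \<open>For a null vector \<open>l\<close> and \<open>a, b, c, d\<close> orthogonal to it, the symmetric product of \<open>l \<and> a\<close> and
  \<open>l \<and> b\<close> lies in \<open>MC\<close> and its product with that of \<open>l \<and> c\<close> and \<open>l \<and> d\<close> vanishes; it is in
  \<open>MC\<^sub>W\<close> if \<open>h(a, b) = 0\<close>. Fixing \<open>l\<close> and a nonnull \<open>a\<close> and letting \<open>b\<close> vary gives trivial
  subalgebras of dimension up to \<open>n - 3\<close>.

  These elements span \<open>MC\<^sub>W\<close>: for a Euclidean inner product adapted to \<open>h\<close>, an element \<open>Z\<close> of the
  orthogonal complement satisfies \<open>Z(v, a, b, v) = 0\<close> for all null \<open>v\<close> and orthogonal
  \<open>a, b\<close> that are orthogonal to \<open>v\<close>. Together with the vanishing of the trace, the Taylor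
  coefficients up to order two of this identity along curves of null vectors kill \<open>Z\<close>.\<close>


section \<open>Curvature-type tensors as functions of four vectors\<close>

lemma length_4E:
  assumes "length vs = 4"
  obtains x y z w where "vs = [x, y, z, w]"
  using assms by (auto simp: numeral_eq_Suc length_Suc_conv)

lemma antisym_transposition:
  assumes "i \<noteq> j" "i < length vs" "j < length vs"
  shows "antisym {i, j} Y vs = (Y vs - Y (vs[i := vs ! j, j := vs ! i])) / 2"
proof -
  have *: "permute_list (Transposition.transpose i j) vs = vs[i := vs ! j, j := vs ! i]"
    using assms by (auto simp: permute_list_def Transposition.transpose_def nth_list_update intro!: nth_equalityI)
  with assms show ?thesis
    by (simp add: antisym_def sum_over_permutations_insert sign_swap_id sign_id)
qed

lemma antisym_012:
  "antisym {0, 1, 2} Y [x, y, z, w] =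
    (Y [x, y, z, w] + Y [y, z, x, w] + Y [z, x, y, w]
      - Y [y, x, z, w] - Y [x, z, y, w] - Y [z, y, x, w]) / 6"
  by (simp add: antisym_def sum_over_permutations_insert sign_compose permutation_swap_id
      sign_swap_id sign_id permute_list_def upt_rec Transposition.transpose_def fact_numeral)

lemma antisym_length: "length vs \<noteq> m \<Longrightarrow> (\<And>vs. length vs \<noteq> m \<Longrightarrow> Y vs = 0) \<Longrightarrow> antisym P Y vs = 0"
  by (simp add: antisym_def)

text \<open>The classical algebraic curvature tensors. Linearity is asked in the first slot only;
  the symmetries carry it to the other slots.\<close>

locale curvature_form =
  fixes R :: "'v::real_vector \<Rightarrow> 'v \<Rightarrow> 'v \<Rightarrow> 'v \<Rightarrow> real"
  assumes linear1: "linear (\<lambda>x. R x y z w)"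
    and skew12: "R y x z w = - R x y z w"
    and skew34: "R x y w z = - R x y z w"
    and bianchi: "R x y z w + R y z x w + R z x y w = 0"
begin

text \<open>Modulo the two skew symmetries, the four Bianchi identities involve six values; a signed
  sum of the four leaves twice the wanted difference.\<close>

lemma pair_sym: "R z w x y = R x y z w"
  using bianchi[of x y z w] bianchi[of y z w x] bianchi[of z w x y] bianchi[of w x y z]
    skew12 skew34 by smt

lemma linear2: "linear (\<lambda>x. R y x z w)"
  using linear_compose_neg[OF linear1[of y z w]] by (simp add: skew12[of _ y])

lemma linear3: "linear (\<lambda>x. R y z x w)"
  using linear1[of w y z] by (simp add: pair_sym)

lemma linear4: "linear (\<lambda>x. R y z w x)"
  using linear2[of w y z] by (simp add: pair_sym)

lemmas lin_simps =
  linear_add[OF linear1] linear_add[OF linear2] linear_add[OF linear3] linear_add[OF linear4]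
  linear_diff[OF linear1] linear_diff[OF linear2] linear_diff[OF linear3] linear_diff[OF linear4]
  linear_cmul[OF linear1] linear_cmul[OF linear2] linear_cmul[OF linear3] linear_cmul[OF linear4]
  linear_0[OF linear1] linear_0[OF linear2] linear_0[OF linear3] linear_0[OF linear4]

lemma skew_refl [simp]: "R x x z w = 0" "R x y z z = 0"
  using skew12[of x x z w] skew34[of x y z z] by simp_all

end

text \<open>Being fixed by the two-index antisymmetrizers is skew symmetry. Given this, the six-term
  sum over \<open>{0,1,2}\<close> collapses to twice the cyclic Bianchi sum.\<close>

lemma MC_iff:
  fixes Y :: "'v::real_vector list \<Rightarrow> real"
  shows "Y \<in> MC \<longleftrightarrow> curvature_form (\<lambda>x y z w. Y [x, y, z, w]) \<and> (\<forall>vs. length vs \<noteq> 4 \<longrightarrow> Y vs = 0)"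
proof
  assume "Y \<in> MC"
  then have T: "Y \<in> tensors 4" and A1: "\<And>vs. antisym {0,1} Y vs = Y vs"
    and A2: "\<And>vs. antisym {2,3} Y vs = Y vs" and A3: "\<And>vs. antisym {0,1,2} Y vs = 0"
    unfolding MC_def by (simp_all only: mem_Collect_eq) simp_all
  have s1: "Y [y, x, z, w] = - Y [x, y, z, w]" for x y z w
    using A1[of "[x, y, z, w]"] by (subst (asm) antisym_transposition) auto
  have s2: "Y [x, y, w, z] = - Y [x, y, z, w]" for x y z w
    using A2[of "[x, y, z, w]"] by (subst (asm) antisym_transposition) auto
  have "curvature_form (\<lambda>x y z w. Y [x, y, z, w])"
  proof (rule curvature_form.intro)
    fix y z w :: 'v
    have "linear (\<lambda>v. Y ([0, y, z, w][0 := v]))"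
      using T unfolding tensors_def by (auto simp del: list_update.simps)
    then show "linear (\<lambda>x. Y [x, y, z, w])" by simp
    fix x :: 'v
    show "Y [x, y, z, w] + Y [y, z, x, w] + Y [z, x, y, w] = 0"
      using A3[of "[x, y, z, w]"] s1[of y x] s1[of z y] s1[of x z] unfolding antisym_012 by simp
  qed (fact s1 s2)+
  with T show "curvature_form (\<lambda>x y z w. Y [x, y, z, w]) \<and> (\<forall>vs. length vs \<noteq> 4 \<longrightarrow> Y vs = 0)"
    by (auto simp: tensors_def)
next
  assume Y: "curvature_form (\<lambda>x y z w. Y [x, y, z, w]) \<and> (\<forall>vs. length vs \<noteq> 4 \<longrightarrow> Y vs = 0)"
  then interpret curvature_form "\<lambda>x y z w. Y [x, y, z, w]" by simp
  from Y have len: "\<And>vs. length vs \<noteq> 4 \<Longrightarrow> Y vs = 0" by simp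
  have "linear (\<lambda>v. Y (vs[i := v]))" if vs: "length vs = 4" and i: "i < 4" for vs :: "'v list" and i
  proof -
    obtain x y z w where [simp]: "vs = [x, y, z, w]" using vs by (rule length_4E)
    consider "i = 0" | "i = 1" | "i = 2" | "i = 3" using i by linarith
    then show ?thesis by cases (simp_all add: linear1 linear2 linear3 linear4)
  qed
  moreover have "antisym {0,1} Y = Y"
  proof
    fix vs show "antisym {0,1} Y vs = Y vs"
    proof (cases "length vs = 4")
      case True
      then obtain x y z w where "vs = [x, y, z, w]" by (rule length_4E)
      then show ?thesis using skew12[of y x z w] by (subst antisym_transposition) auto
    qed (use len in \<open>simp add: antisym_length\<close>)
  qed
  moreover have "antisym {2,3} Y = Y"
  proof
    fix vs show "antisym {2,3} Y vs = Y vs"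
    proof (cases "length vs = 4")
      case True
      then obtain x y z w where "vs = [x, y, z, w]" by (rule length_4E)
      then show ?thesis using skew34[of x y w z] by (subst antisym_transposition) auto
    qed (use len in \<open>simp add: antisym_length\<close>)
  qed
  moreover have "antisym {0,1,2} Y = 0"
  proof
    fix vs show "antisym {0,1,2} Y vs = 0 vs"
    proof (cases "length vs = 4")
      case True
      then obtain x y z w where "vs = [x, y, z, w]" by (rule length_4E)
      then show ?thesis using bianchi[of x y z w] skew12[of y x z w] skew12[of z y x w] skew12[of x z y w]
        by (simp only: antisym_012) simp
    qed (use len in \<open>simp add: antisym_length\<close>)
  qed
  ultimately show "Y \<in> MC" using len by (simp add: MC_def tensors_def)
qed


section \<open>Products of decomposable bivectors\<close>

locale metric =
  fixes h :: "'v::real_vector \<Rightarrow> 'v \<Rightarrow> real"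
  assumes metric: "metric_vector_space h"
begin

lemma sym: "h x y = h y x"
  and nondegenerate: "(\<And>y. h x y = 0) \<Longrightarrow> x = 0"
  using metric unfolding metric_vector_space_def by auto

lemma linear_h: "linear (h x)" "linear (\<lambda>x. h x y)"
  using metric unfolding metric_vector_space_def bilinear_def by auto

lemmas h_simps [simp] =
  linear_add[OF linear_h(1)] linear_add[OF linear_h(2)]
  linear_diff[OF linear_h(1)] linear_diff[OF linear_h(2)]
  linear_cmul[OF linear_h(1)] linear_cmul[OF linear_h(2)]
  linear_neg[OF linear_h(1)] linear_neg[OF linear_h(2)]
  linear_0[OF linear_h(1)] linear_0[OF linear_h(2)]

lemma ext_basis: "independent (extend_basis ({} :: 'v set))" "span (extend_basis ({} :: 'v set)) = UNIV"
  by (simp_all add: real_vector.independent_extend_basis real_vector.span_extend_basis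
        real_vector.independent_empty)

lemma trace_add: "metric_trace h (\<lambda>p q. F p q + G p q) = metric_trace h F + metric_trace h G"
  by (simp add: metric_trace_def sum.distrib)

lemma trace_cmul: "metric_trace h (\<lambda>p q. c * F p q) = c * metric_trace h F"
  by (simp add: metric_trace_def sum_distrib_left)

lemma trace_0: "metric_trace h (\<lambda>p q. 0) = 0"
  by (simp add: metric_trace_def)

text \<open>Index lowering followed by contraction is substitution. With this rule and its mirror
  image, the traces of wedge products below are computed without choosing a basis.\<close>

lemma trace_left:
  assumes "linear G"
  shows "metric_trace h (\<lambda>p q. h u p * G q) = G u"
proof -
  have "G u = G (\<Sum>b\<in>extend_basis {}. h u b *\<^sub>R dual_vec h (extend_basis {}) b)"
    by (simp add: sum_dual_vec[OF metric ext_basis])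
  also have "\<dots> = metric_trace h (\<lambda>p q. h u p * G q)"
    by (simp add: metric_trace_def linear_sum[OF assms] linear_cmul[OF assms])
  finally show ?thesis by simp
qed

lemma trace_right:
  assumes "linear G"
  shows "metric_trace h (\<lambda>p q. G p * h u q) = G u"
proof -
  have "G u = G (\<Sum>b\<in>extend_basis {}. h (dual_vec h (extend_basis {}) b) u *\<^sub>R b)"
    by (simp add: sum_dual_vec'[OF metric ext_basis])
  also have "\<dots> = metric_trace h (\<lambda>p q. G p * h u q)"
    by (simp add: metric_trace_def linear_sum[OF assms] linear_cmul[OF assms] sym[of u] mult.commute)
  finally show ?thesis by simp
qed

lemma trace_h: "metric_trace h h = real (dim (UNIV :: 'v set))"
proof -
  have "metric_trace h h = (\<Sum>b\<in>extend_basis ({} :: 'v set). 1)"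
    unfolding metric_trace_def
    by (intro sum.cong) (auto simp: sym[of _ "dual_vec _ _ _"] dual_vec[OF metric ext_basis])
  also have "card (extend_basis ({} :: 'v set)) = dim (span (extend_basis ({} :: 'v set)))"
    by (simp only: dim_span_eq_card_independent[OF ext_basis(1)])
  then have "(\<Sum>b\<in>extend_basis ({} :: 'v set). 1) = real (dim (UNIV :: 'v set))"
    by (simp add: ext_basis)
  finally show ?thesis .
qed

definition wedge :: "'v \<Rightarrow> 'v \<Rightarrow> 'v \<Rightarrow> 'v \<Rightarrow> real" where
  "wedge a b x y = h a x * h b y - h b x * h a y"

definition wedge_prod :: "'v \<Rightarrow> 'v \<Rightarrow> 'v \<Rightarrow> 'v list \<Rightarrow> real" where
  "wedge_prod l a b vs = (if length vs = 4 then
     wedge l a (vs ! 0) (vs ! 1) * wedge l b (vs ! 2) (vs ! 3) +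
     wedge l b (vs ! 0) (vs ! 1) * wedge l a (vs ! 2) (vs ! 3) else 0)"

lemma wedge_prod_simps [simp]:
  "wedge_prod l a b [x, y, z, w] = wedge l a x y * wedge l b z w + wedge l b x y * wedge l a z w"
  "length vs \<noteq> 4 \<Longrightarrow> wedge_prod l a b vs = 0"
  by (simp_all add: wedge_prod_def)

lemma linear_wedge: "linear (\<lambda>x. wedge a b x y)" "linear (wedge a b x)"
  by (rule linearI; simp add: wedge_def algebra_simps)+

lemma trace_wedge_left:
  assumes "linear G"
  shows "metric_trace h (\<lambda>p q. wedge a b p x * G q) = h b x * G a - h a x * G b"
proof -
  have "metric_trace h (\<lambda>p q. wedge a b p x * G q)
      = metric_trace h (\<lambda>p q. h b x * (h a p * G q) + - h a x * (h b p * G q))"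
    by (simp add: wedge_def algebra_simps)
  then show ?thesis by (simp only: trace_add trace_cmul trace_left[OF assms])
qed

lemma trace_wedge_right:
  assumes "linear G"
  shows "metric_trace h (\<lambda>p q. wedge a b x p * G q) = h a x * G b - h b x * G a"
  using trace_wedge_left[OF assms, of b a x] by (simp add: wedge_def mult.commute)

lemma trace_wedge:
  assumes "linear G"
  shows "metric_trace h (\<lambda>p q. G p * wedge a b x q) = h a x * G b - h b x * G a"
proof -
  have "metric_trace h (\<lambda>p q. G p * wedge a b x q)
      = metric_trace h (\<lambda>p q. h a x * (G p * h b q) + - h b x * (G p * h a q))"
    by (simp add: wedge_def algebra_simps)
  then show ?thesis by (simp only: trace_add trace_cmul trace_right[OF assms])
qed

text \<open>The obstruction to the Bianchi identity for a symmetric product of bivectors is their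
  exterior product, which vanishes here because both contain \<open>l\<close>.\<close>

lemma wedge_prod_in_MC: "wedge_prod l a b \<in> MC"
  unfolding MC_iff
proof (intro conjI curvature_form.intro)
  fix y z w
  show "linear (\<lambda>x. wedge_prod l a b [x, y, z, w])"
    by (rule linearI) (simp_all add: wedge_def algebra_simps)
qed (simp_all add: wedge_def algebra_simps)

text \<open>Every term of the trace contains one of the four given products; \<open>h a b\<close> is
  the coefficient of the square of the covector of \<open>l\<close>.\<close>

lemma wedge_prod_in_MC\<^sub>W:
  assumes "h l l = 0" "h l a = 0" "h l b = 0" "h a b = 0"
  shows "wedge_prod l a b \<in> MC\<^sub>W h"
proof -
  have "\<rho> h (wedge_prod l a b) x y = 0" for x y
  proof -
    have "\<rho> h (wedge_prod l a b) x y = (h l y * wedge l a b x - h b y * wedge l a l x)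
         + (h l y * wedge l b a x - h a y * wedge l b l x)"
      by (simp add: \<rho>_def trace_add trace_wedge[OF linear_wedge(1)])
    also have "\<dots> = 0" using assms sym[of a l] sym[of b l] sym[of b a] by (simp add: wedge_def)
    finally show ?thesis .
  qed
  then show ?thesis by (simp add: MC\<^sub>W_def wedge_prod_in_MC fun_eq_iff)
qed

text \<open>Here \<open>G\<close> stands for a tensor seen as a function of two of its slots. As
  \<open>G\<close> kills \<open>l\<close>, only the terms that insert \<open>a\<close> and
  \<open>b\<close> survive, and \<open>l\<close> is left in the two free slots.\<close>

lemma contract_wedge_prod:
  assumes G: "\<And>p. linear (G p)" "\<And>q. linear (\<lambda>p. G p q)" and l: "\<And>p. G p l = 0" "\<And>q. G l q = 0"
  shows "metric_trace h (\<lambda>p p'. metric_trace h (\<lambda>q q'. wedge_prod l a b [p, x, y, q] * G p' q'))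
      = - (G a b + G b a) * (h l x * h l y)"
proof -
  have "metric_trace h (\<lambda>q q'. wedge_prod l a b [p, x, y, q] * G p' q')
    = metric_trace h (\<lambda>q q'. wedge l a p x * (wedge l b y q * G p' q') +
        wedge l b p x * (wedge l a y q * G p' q'))" for p p'
    by (simp add: algebra_simps)
  then have *: "metric_trace h (\<lambda>q q'. wedge_prod l a b [p, x, y, q] * G p' q')
    = h l y * (wedge l a p x * G p' b) + h l y * (wedge l b p x * G p' a)" for p p'
    by (simp only: trace_add trace_cmul trace_wedge_right[OF G(1)] l) (simp add: algebra_simps)
  show ?thesis
    by (simp only: * trace_add trace_cmul trace_wedge_left[OF G(2)] l) (simp add: algebra_simps)
qed

text \<open>The second factor vanishes when \<open>l\<close> is put into any slot, so
  \<open>contract_wedge_prod\<close> applies to each pair of positions. Two positions in the same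
  skew pair contribute zero; the others contribute, up to sign, one multiple of the product of the
  four values of \<open>h l\<close>, and the signs cancel.\<close>

lemma mc_mult_wedge_prod:
  assumes l: "h l l = 0" "h l a = 0" "h l b = 0" "h l c = 0" "h l d = 0"
  shows "mc_mult h (wedge_prod l a b) (wedge_prod l c d) = 0"
proof
  fix vs :: "'v list"
  have l': "h a l = 0" "h b l = 0" "h c l = 0" "h d l = 0" using l sym by metis+
  let ?Y = "wedge_prod l c d"
  show "mc_mult h (wedge_prod l a b) ?Y vs = 0 vs"
  proof (cases "length vs = 4")
    case True
    have T: "?Y \<in> tensors 4" using wedge_prod_in_MC unfolding MC_def by blast
    have Yl: "?Y (us[i := l]) = 0" if us: "length us = 4" and i: "i < 4" for us i
    proof -
      obtain x y z w where [simp]: "us = [x, y, z, w]" using us by (rule length_4E)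
      consider "i = 0" | "i = 1" | "i = 2" | "i = 3" using i by linarith
      then show ?thesis using l l' by cases (simp_all add: wedge_def)
    qed
    have *: "metric_trace h (\<lambda>p p'. metric_trace h (\<lambda>q q'.
          wedge_prod l a b [p, vs ! r, vs ! s, q] * ?Y (vs[r := p', s := q'])))
        = - (?Y (vs[r := a, s := b]) + ?Y (vs[r := b, s := a])) * (h l (vs ! r) * h l (vs ! s))"
      if "r < 4" "s < 4" "r \<noteq> s" for r s
    proof (rule contract_wedge_prod)
      show "linear (\<lambda>q. ?Y (vs[r := p, s := q]))" for p
        using T True that by (auto simp: tensors_def)
      show "linear (\<lambda>p. ?Y (vs[r := p, s := q]))" for q
        using T True that by (subst list_update_swap) (auto simp: tensors_def)
      show "?Y (vs[r := p, s := l]) = 0" for p using Yl True that by simp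
      show "?Y (vs[r := l, s := q]) = 0" for q using Yl True that by (subst list_update_swap) simp_all
    qed
    have pairs: "{(r, s). r < length vs \<and> s < length vs \<and> r \<noteq> s} =
      {(0,1),(0,2),(0,3),(1,0),(1,2),(1,3),(2,0),(2,1),(2,3),(3,0),(3,1),(3,2)}"
    proof -
      have "(r::nat) < 4 \<longleftrightarrow> r = 0 \<or> r = 1 \<or> r = 2 \<or> r = 3" for r by linarith
      with True show ?thesis by (simp only: set_eq_iff mem_Collect_eq) (force simp del: One_nat_def)
    qed
    have "(\<Sum>(r, s) | r < length vs \<and> s < length vs \<and> r \<noteq> s.
        metric_trace h (\<lambda>p p'. metric_trace h (\<lambda>q q'.
          wedge_prod l a b [p, vs ! r, vs ! s, q] * ?Y (vs[r := p', s := q'])))) =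
      (\<Sum>(r, s) | r < length vs \<and> s < length vs \<and> r \<noteq> s.
         - (?Y (vs[r := a, s := b]) + ?Y (vs[r := b, s := a])) * (h l (vs ! r) * h l (vs ! s)))"
    proof (rule sum.cong, goal_cases)
      case (2 rs)
      then obtain r s where rs: "rs = (r, s)" and "r < 4" "s < 4" "r \<noteq> s" using True by auto
      then show ?case unfolding rs prod.case by (intro *)
    qed simp
    also have "\<dots> = 0"
    proof -
      obtain x y z w where [simp]: "vs = [x, y, z, w]" using True by (rule length_4E)
      show ?thesis unfolding pairs using l l' by (simp add: wedge_def algebra_simps)
    qed
    finally show ?thesis by (simp add: mc_mult_def hat_def)
  qed (simp add: mc_mult_def hat_def trace_0)
qed
end


section \<open>Forms vanishing on null vectors\<close>

lemmas real_expand = real_scaleR_def distrib_left distrib_right left_diff_distrib right_diff_distrib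
  mult.assoc mult.left_commute mult.commute mult_zero_left mult_zero_right
  mult_minus_left mult_minus_right

text \<open>Five sample points give an invertible linear system for the five coefficients.\<close>

lemma quartic_coeffs_zero:
  fixes c0 c1 c2 c3 c4 :: real
  assumes "\<And>t. c0 + c1 * t + c2 * t^2 + c3 * t^3 + c4 * t^4 = 0"
  shows "c0 = 0" "c1 = 0" "c2 = 0" "c3 = 0" "c4 = 0"
  using assms[of 0] assms[of 1] assms[of "-1"] assms[of 2] assms[of "-2"] by simp_all

text \<open>A hyperbolic pair \<open>l\<close>, \<open>m\<close> and a nonnull \<open>u\<close>
  orthogonal to it. The disjunction in \<open>null\<close> makes the locale symmetric under exchange
  of \<open>l\<close> and \<open>m\<close>. Here \<open>a\<close> and \<open>b\<close> need not be
  orthogonal to each other; \<open>null_sectional_eq_0\<close> later supplies this stronger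
  form.\<close>

locale null_frame = metric h + curvature_form R
  for h R :: "'v::real_vector \<Rightarrow> _" +
  fixes l m u :: 'v
  assumes frame: "h l l = 0" "h m m = 0" "h l m = 1" "h l u = 0" "h m u = 0" "h u u \<noteq> 0"
    and null: "\<lbrakk>h v v = 0; h v m = 1 \<or> h v l = 1; h v a = 0; h v b = 0\<rbrakk> \<Longrightarrow> R v a b v = 0"
    and ricci: "metric_trace h (\<lambda>p q. R p x y q) = 0"
    and dim: "dim (UNIV :: 'v set) \<noteq> 1"
begin

definition "W = {x. h l x = 0 \<and> h m x = 0}"

lemma frame': "h m l = 1" "h u l = 0" "h u m = 0"
  using frame sym by metis+

lemma W_iff: "x \<in> W \<longleftrightarrow> h l x = 0 \<and> h m x = 0 \<and> h x l = 0 \<and> h x m = 0"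
  using sym[of x l] sym[of x m] by (auto simp: W_def)

lemma W_combine: "x \<in> W \<Longrightarrow> y \<in> W \<Longrightarrow> x + y \<in> W" "x \<in> W \<Longrightarrow> c *\<^sub>R x \<in> W"
  "x \<in> W \<Longrightarrow> y \<in> W \<Longrightarrow> x - y \<in> W"
  by (auto simp: W_def)

lemma u_W: "u \<in> W"
  by (simp add: W_def frame)

lemma decompose:
  obtains s t x' where "x = s *\<^sub>R l + t *\<^sub>R m + x'" "x' \<in> W" "s = h x m" "t = h x l"
proof
  show "x = h x m *\<^sub>R l + h x l *\<^sub>R m + (x - h x m *\<^sub>R l - h x l *\<^sub>R m)" by simp
  show "x - h x m *\<^sub>R l - h x l *\<^sub>R m \<in> W"
    by (simp add: W_def frame frame' sym[of x l] sym[of x m])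
qed simp_all

text \<open>The null vectors \<open>v = l + t w - t\<^sup>2 h(w, w) / 2 m\<close> with \<open>w\<close> orthogonal to \<open>l\<close> and \<open>m\<close>
  form a parabola; the vectors \<open>a - t h(a, w) m\<close> and \<open>b - t h(b, w) m\<close> stay orthogonal to it.\<close>

lemma
  assumes "w \<in> W" "a \<in> W" "b \<in> W"
  shows null_order1: "R w a b l + R l a b w - h a w * R l m b l - h b w * R l a m l = 0"
    and null_order2: "R w a b w - h w w / 2 * (R m a b l + R l a b m)
      - h a w * (R w m b l + R l m b w) - h b w * (R l a m w + R w a m l)
      + h a w * h b w * R l m m l = 0"
proof -
  define g p q where "g = h w w / 2" and "p = h a w" and "q = h b w"
  \<comment> \<open>The coefficients of orders three and four get names only to complete the
    quartic; orders one and two are the ones extracted.\<close>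
  define c3 where "c3 = - g * (R w a b m + R m a b w) - p * R w m b w - q * R w a m w
    + g * q * R m a m l + g * p * R l m b m + p * q * (R l m m w + R w m m l)"
  define c4 where "c4 = g * g * R m a b m + g * p * R w m b m + g * q * R m a m w + p * q * R w m m w"
  have W: "h l w = 0" "h m w = 0" "h w l = 0" "h w m = 0" "h l a = 0" "h m a = 0" "h a l = 0" "h a m = 0"
    "h l b = 0" "h m b = 0" "h b l = 0" "h b m = 0"
    using assms by (auto simp: W_iff)
  have "R l a b l + (R w a b l + R l a b w - p * R l m b l - q * R l a m l) * t
      + (R w a b w - g * (R m a b l + R l a b m)
      - p * (R w m b l + R l m b w) - q * (R l a m w + R w a m l)
      + p * q * R l m m l) * t^2 + c3 * t^3 + c4 * t^4 = 0" for t
  proof -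
    have "R (l + t *\<^sub>R w - (t * t * g) *\<^sub>R m) (a - (t * p) *\<^sub>R m) (b - (t * q) *\<^sub>R m)
        (l + t *\<^sub>R w - (t * t * g) *\<^sub>R m) = 0"
      by (rule null) (simp_all add: frame frame' W g_def p_def q_def sym[of w a] sym[of w b])
    then show ?thesis
      unfolding lin_simps skew_refl c3_def c4_def power2_eq_square power3_eq_cube power4_eq_xxxx
      by (simp only: real_expand)
  qed
  from quartic_coeffs_zero(2,3)[OF this]
  show "R w a b l + R l a b w - h a w * R l m b l - h b w * R l a m l = 0"
    and "R w a b w - h w w / 2 * (R m a b l + R l a b m)
      - h a w * (R w m b l + R l m b w) - h b w * (R l a m w + R w a m l)
      + h a w * h b w * R l m m l = 0"
    by (simp_all add: g_def p_def q_def)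
qed

lemma R_llWW: "a \<in> W \<Longrightarrow> b \<in> W \<Longrightarrow> R l a b l = 0"
  by (rule null) (simp_all add: frame W_iff)

text \<open>\<open>null_order1\<close> brought to a normal form with \<open>l\<close> in the last
  slot; \<open>order2\<close> does the same for \<open>null_order2\<close>.\<close>

lemma order1:
  assumes "w \<in> W" "a \<in> W" "b \<in> W"
  shows "R w a b l + R w b a l = h a w * R l m b l + h b w * R l m a l"
proof -
  have "R l a b w = R w b a l" using pair_sym[of l a b w] skew12[of b w l a] skew34[of w b a l] by simp
  moreover have "R l a m l = R l m a l" using pair_sym[of l a m l] skew12[of m l l a] skew34[of l m a l] by simp
  ultimately show ?thesis using null_order1[OF assms] by simp
qed

text \<open>Putting \<open>u\<close> for all three vectors makes the left side of
  \<open>order1\<close> vanish by skew symmetry, which settles \<open>u\<close> as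
  \<open>h u u\<close> is nonzero. Two more substitutions carry this over to
  \<open>w\<close>.\<close>

lemma R_lmWl:
  assumes w: "w \<in> W" shows "R l m w l = 0"
proof -
  have u: "R l m u l = 0" using order1[OF u_W u_W u_W] frame by simp
  have "R w u u l = 0" using order1[OF w u_W u_W] u by simp
  then have "R u w u l = 0" using skew12[of u w u l] by simp
  then show ?thesis using order1[OF u_W w u_W] u frame by simp
qed

text \<open>The right side of \<open>order1\<close> is now zero, so the expression is skew in slots
  2 and 3 as well as in 1 and 2. A totally skew expression is killed by Bianchi.\<close>

lemma R_WWWl:
  assumes "w \<in> W" "a \<in> W" "b \<in> W"
  shows "R w a b l = 0"
proof -
  have *: "R x y z l = - R x z y l" if "x \<in> W" "y \<in> W" "z \<in> W" for x y z
    using order1[OF that] R_lmWl that by simp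
  show ?thesis
    using bianchi[of w a b l] *[of a b w] *[of b w a] *[of a w b] skew12[of a w b l] skew12[of b a w l] assms
    by simp
qed

lemma order2:
  assumes "w \<in> W" "a \<in> W" "b \<in> W"
  shows "R w a b w = h w w / 2 * (R m a b l + R m b a l)
      + h a w * (R m b w l - 2 * R m w b l) + h b w * (R m a w l - 2 * R m w a l)
      - h a w * h b w * R l m m l"
proof -
  have 1: "R l x y m = R m y x l" for x y
    using pair_sym[of l x y m] skew12[of y m l x] skew34[of m y x l] by simp
  have 2: "R l m b w = R m b w l - R m w b l"
    using pair_sym[of l m b w] bianchi[of b w l m] skew12[of w l b m] 1[of w b] 1[of b w] by simp
  have 3: "R l a m w = - R m w a l"
    using pair_sym[of l a m w] skew34[of m w l a] by simp
  have 4: "R w a m l = R m a w l - R m w a l"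
    using bianchi[of w a m l] skew12[of a m w l] by simp
  show ?thesis using null_order2[OF assms] skew12[of w m b l]
    by (simp add: 1 2 3 4 algebra_simps)
qed

text \<open>For equal arguments \<open>order2\<close> says that the product of the quadratic forms
  \<open>h x x\<close> and \<open>f\<close> vanishes on \<open>W\<close>. The first is nonzero at
  \<open>u\<close>, so \<open>f\<close> is zero: compare coefficients along \<open>w + t u\<close>,
  starting from the highest.\<close>

lemma phi_diag:
  assumes w: "w \<in> W"
  shows "R m w w l = - h w w * R l m m l"
proof -
  define f where "f x = R m x x l + h x x * R l m m l" for x
  have f: "h x x * f x = 0" if "x \<in> W" for x
    using order2[OF that that that] by (simp add: f_def algebra_simps)
  \<comment> \<open>The coefficient of \<open>t\<close> in \<open>f (w + t u)\<close>.\<close>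
  define F1 where "F1 = R m w u l + R m u w l + 2 * h w u * R l m m l"
  have "h w w * f w + (2 * h w u * f w + h w w * F1) * t
      + (h w w * f u + 2 * h w u * F1 + h u u * f w) * t^2
      + (2 * h w u * f u + h u u * F1) * t^3 + h u u * f u * t^4 = 0" for t
  proof -
    have "h (w + t *\<^sub>R u) (w + t *\<^sub>R u) * f (w + t *\<^sub>R u) = 0"
      by (intro f W_combine u_W w)
    then show ?thesis
      unfolding f_def F1_def power2_eq_square power3_eq_cube power4_eq_xxxx lin_simps h_simps
        sym[of u w]
      by (simp only: real_expand)
  qed
  note c = quartic_coeffs_zero[OF this]
  have "f u = 0" using c(5) frame by simp
  moreover from this have "F1 = 0" using c(4) frame by simp
  ultimately have "f w = 0" using c(3) frame by simp
  then show ?thesis by (simp add: f_def)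
qed

text \<open>Polarizing \<open>phi_diag\<close> controls only the symmetric part. A second relation
  comes from \<open>order2\<close> with its first two vectors equal, where the left side vanishes;
  it settles nonnull vectors. A null \<open>w\<close> differs by \<open>u\<close> from
  \<open>w + u\<close> and \<open>w - u\<close>, at least one of which is nonnull.\<close>

lemma phi:
  assumes w: "w \<in> W" and b: "b \<in> W"
  shows "R m w b l = - h w b * R l m m l"
proof -
  define k where "k = R l m m l"
  have nonnull: "R m x b l = - h x b * k" if x: "x \<in> W" "h x x \<noteq> 0" for x
  proof -
    have diag: "R m y y l = - h y y * k" if "y \<in> W" for y
      using phi_diag[OF that] by (simp add: k_def)
    have B: "R m b x l = - 2 * h x b * k - R m x b l"
      using diag[OF W_combine(1)[OF x(1) b]] unfolding lin_simps h_simps diag[OF x(1)] diag[OF b] sym[of b x]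
      by (simp only: real_expand)
    have "0 = h x x / 2 * (R m x b l + R m b x l) + h x x * (R m b x l - 2 * R m x b l)
        + h x b * (R m x x l - 2 * R m x x l) - h x x * h x b * k"
      using order2[OF x(1) x(1) b] unfolding skew_refl k_def sym[of b x] .
    also have "\<dots> = - 3 * (h x x * (R m x b l + h x b * k))"
      unfolding B diag[OF x(1)] by (simp add: field_simps)
    finally show ?thesis using x(2) by simp
  qed
  have "R m w b l = - h w b * k"
  proof (cases "h w w = 0")
    case True
    then have "h (w + u) (w + u) + h (w - u) (w - u) = 2 * h u u" by simp
    with frame(6) consider "h (w + u) (w + u) \<noteq> 0" | "h (w - u) (w - u) \<noteq> 0"
      by linarith
    then show ?thesis
    proof cases
      case 1
      from nonnull[OF W_combine(1)[OF w u_W] this] nonnull[OF u_W frame(6)] show ?thesis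
        unfolding lin_simps h_simps by (simp only: real_expand)
    next
      case 2
      from nonnull[OF W_combine(3)[OF w u_W] this] nonnull[OF u_W frame(6)] show ?thesis
        unfolding lin_simps h_simps by (simp only: real_expand)
    qed
  qed (use nonnull w in blast)
  then show ?thesis by (simp add: k_def)
qed

lemma mirror: "null_frame h R m l u"
proof (rule null_frame.intro)
  show "metric h" "curvature_form R" by unfold_locales
  show "null_frame_axioms h R m l u"
    by (rule null_frame_axioms.intro) (use frame frame' null ricci dim in auto)
qed

text \<open>The vanishing trace enters this locale here. In the frame, \<open>R x l m y\<close> is a
  combination of \<open>h\<close> and a product of covectors, with coefficients \<open>-k\<close>
  and \<open>k\<close>, so its trace is \<open>k\<close> times one minus the dimension.\<close>

lemma kappa: "R l m m l = 0"
proof -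
  interpret mir: null_frame h R m l u by (rule mirror)
  have mirW: "mir.W = W" by (auto simp: W_def mir.W_def)
  define k where "k = R l m m l"
  have "R x l m y = - k * h x y + k * (h m x * h l y)" for x y
  proof -
    obtain s t x' where x: "x = s *\<^sub>R l + t *\<^sub>R m + x'" "x' \<in> W" by (rule decompose)
    obtain s2 t2 y' where y: "y = s2 *\<^sub>R l + t2 *\<^sub>R m + y'" "y' \<in> W" by (rule decompose)
    have "R m l m y' = 0" using mir.R_lmWl[of y'] skew34[of m l y' m] y(2) mirW by simp
    moreover have "R x' l m l = 0"
      using R_lmWl[OF x(2)] pair_sym[of x' l m l] skew12[of l m x' l] by simp
    moreover have "R x' l m y' = - k * h x' y'"
      using phi[OF y(2) x(2)] pair_sym[of x' l m y'] by (simp add: k_def sym[of x' y'])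
    moreover have "R m l m l = - k" using skew12[of l m m l] by (simp add: k_def)
    moreover have "h l x' = 0" "h m x' = 0" "h x' l = 0" "h x' m = 0" "h l y' = 0" "h m y' = 0"
      "h y' l = 0" "h y' m = 0" using x(2) y(2) by (auto simp: W_iff)
    ultimately show ?thesis unfolding x(1) y(1) lin_simps h_simps frame frame' skew_refl k_def[symmetric]
      by (simp only: real_expand)
  qed
  then have "metric_trace h (\<lambda>p q. R p l m q) = - k * real (dim (UNIV :: 'v set)) + k * h l m"
    by (simp only: trace_add trace_cmul trace_h trace_right[OF linear_h(1)])
       (simp add: frame frame')
  then have "k * (1 - real (dim (UNIV :: 'v set))) = 0" using ricci by (simp add: frame algebra_simps)
  then show ?thesis using dim by (simp add: k_def)
qed

text \<open>The frame components of \<open>x\<close> and \<open>y\<close> are covered by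
  \<open>R_llWW\<close>, \<open>R_lmWl\<close> and \<open>kappa\<close>.\<close>

lemma R_lxyl: "R l x y l = 0"
proof -
  obtain s t x' where x: "x = s *\<^sub>R l + t *\<^sub>R m + x'" "x' \<in> W" by (rule decompose)
  obtain s2 t2 y' where y: "y = s2 *\<^sub>R l + t2 *\<^sub>R m + y'" "y' \<in> W" by (rule decompose)
  have "R l x' m l = 0"
    using pair_sym[of l x' m l] skew12[of m l l x'] skew34[of l m x' l] R_lmWl[OF x(2)] by simp
  then show ?thesis using kappa R_lmWl[OF y(2)] R_llWW[OF x(2) y(2)]
    by (simp add: x(1) y(1) lin_simps)
qed

lemma R_mxyl: "R m x y l = 0"
proof -
  interpret mir: null_frame h R m l u by (rule mirror)
  obtain s t x' where x: "x = s *\<^sub>R l + t *\<^sub>R m + x'" "x' \<in> W" by (rule decompose)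
  obtain s2 t2 y' where y: "y = s2 *\<^sub>R l + t2 *\<^sub>R m + y'" "y' \<in> W" by (rule decompose)
  have 1: "R m l z l = 0" for z using R_lxyl[of m z] skew12[of l m z l] by simp
  have 2: "R m z m l = 0" for z
    using mir.R_lxyl[of l z] pair_sym[of m z m l] skew34[of m l m z] by simp
  show ?thesis using phi[OF x(2) y(2)] kappa 1 2
    by (simp add: x(1) y(1) lin_simps)
qed

text \<open>The two preceding lemmas reduce \<open>x\<close> and \<open>y\<close> to
  \<open>W\<close>. Then \<open>z = m\<close> falls to Bianchi and \<open>z\<close> in
  \<open>W\<close> to \<open>R_WWWl\<close>.\<close>

lemma R_xyzl: "R x y z l = 0"
proof -
  have 1: "R x l z l = 0" "R x m z l = 0" for x z
    using R_lxyl[of x z] R_mxyl[of x z] skew12[of x l z l] skew12[of x m z l] by simp_all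
  obtain s t x' where x: "x = s *\<^sub>R l + t *\<^sub>R m + x'" "x' \<in> W" by (rule decompose)
  obtain s2 t2 y' where y: "y = s2 *\<^sub>R l + t2 *\<^sub>R m + y'" "y' \<in> W" by (rule decompose)
  obtain s3 t3 z' where z: "z = s3 *\<^sub>R l + t3 *\<^sub>R m + z'" "z' \<in> W" by (rule decompose)
  have "R x' y' m l = 0" using bianchi[of x' y' m l] 1 R_mxyl by simp
  with R_WWWl[OF x(2) y(2) z(2)] show ?thesis
    by (simp add: x(1) y(1) z(1) lin_simps 1 R_lxyl R_mxyl)
qed

text \<open>With \<open>l\<close> and \<open>m\<close> excluded from every slot, only the
  restriction to \<open>W\<close> remains.\<close>

lemma R_eq_0: "R x y z w = 0"
proof -
  interpret mir: null_frame h R m l u by (rule mirror)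
  have 4: "R x y z l = 0" "R x y z m = 0" for x y z
    using R_xyzl mir.R_xyzl by simp_all
  have 3: "R x y l z = 0" "R x y m z = 0" for x y z
    using 4 skew34[of x y z l] skew34[of x y z m] by simp_all
  have 2: "R x l y z = 0" "R x m y z = 0" for x y z
    using 4 pair_sym[of x l y z] pair_sym[of x m y z] by simp_all
  have 1: "R l x y z = 0" "R m x y z = 0" for x y z
    using 3 pair_sym[of l x y z] pair_sym[of m x y z] by simp_all
  \<comment> \<open>The right side of \<open>order2\<close> is gone. Polarization gives skew
    symmetry in slots 1 and 4, hence in 1 and 3, so Bianchi applies as in
    \<open>R_WWWl\<close>.\<close>
  have diag: "R a b c a = 0" if "a \<in> W" "b \<in> W" "c \<in> W" for a b c
    using order2[OF that] by (simp add: 1)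
  have skew14: "R a b c d = - R d b c a" if "a \<in> W" "b \<in> W" "c \<in> W" "d \<in> W" for a b c d
    using diag[OF W_combine(1)[OF that(1,4)] that(2,3)] diag[OF that(1-3)] diag[OF that(4,2,3)]
    by (simp add: lin_simps)
  have skew13: "R a b c d = - R c b a d" if "a \<in> W" "b \<in> W" "c \<in> W" "d \<in> W" for a b c d
    using skew14[of a b c d] skew14[of d b a c] skew34[of d b c a] skew34[of c b d a] that by simp
  obtain s t x' where x: "x = s *\<^sub>R l + t *\<^sub>R m + x'" "x' \<in> W" by (rule decompose)
  obtain s2 t2 y' where y: "y = s2 *\<^sub>R l + t2 *\<^sub>R m + y'" "y' \<in> W" by (rule decompose)
  obtain s3 t3 z' where z: "z = s3 *\<^sub>R l + t3 *\<^sub>R m + z'" "z' \<in> W" by (rule decompose)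
  obtain s4 t4 w' where w: "w = s4 *\<^sub>R l + t4 *\<^sub>R m + w'" "w' \<in> W" by (rule decompose)
  have "R x' y' z' w' = 0"
    using bianchi[of x' y' z' w'] skew13[of x' y' z' w'] skew13[of y' z' x' w'] skew13[of z' x' y' w']
      skew12[of z' y' x' w'] skew12[of x' z' y' w'] skew12[of y' x' z' w'] x(2) y(2) z(2) w(2) by smt
  then show ?thesis unfolding x(1) y(1) z(1) w(1) lin_simps 1 2 3 4 by simp
qed

end


section \<open>Orthogonal complements for a definite form\<close>

text \<open>Gram-Schmidt, phrased for a finite-dimensional \<open>V\<close> inside a possibly
  infinite-dimensional ambient space, such as all functions on lists; \<open>E\<close> is definite
  on \<open>V\<close> only.\<close>

lemma ex_orthogonal_complement_vector:
  fixes E :: "'a::real_vector \<Rightarrow> 'a \<Rightarrow> real"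
  assumes E: "\<And>x. linear (E x)" "\<And>y. linear (\<lambda>x. E x y)"
    and U: "subspace U" "U \<subset> V" and V: "subspace V" "V \<subseteq> span T" "finite T"
    and definite: "\<And>x. x \<in> V \<Longrightarrow> E x x = 0 \<Longrightarrow> x = 0"
  obtains z where "z \<in> V" "z \<noteq> 0" "\<And>x. x \<in> U \<Longrightarrow> E z x = 0"
proof -
  have proj: "\<exists>y\<in>span S. \<forall>s\<in>span S. E (x - y) s = 0" if "finite S" "S \<subseteq> V" "x \<in> V" for S x
    using that
  proof (induction S arbitrary: x rule: finite_induct)
    case empty
    then show ?case by (auto simp: linear_0[OF E(1)])
  next
    case (insert a S)
    from insert have S: "S \<subseteq> V" and a: "a \<in> V" by auto
    obtain a' where a': "a' \<in> span S" "\<And>s. s \<in> span S \<Longrightarrow> E (a - a') s = 0"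
      using insert.IH[OF S a] by blast
    obtain x' where x': "x' \<in> span S" "\<And>s. s \<in> span S \<Longrightarrow> E (x - x') s = 0"
      using insert.IH[OF S insert.prems(2)] by blast
    \<comment> \<open>The part of the new vector orthogonal to the old span; \<open>y\<close> adds
      to the old projection the component along \<open>e\<close>. If \<open>E e e\<close> is zero,
      then \<open>e\<close> is zero by definiteness and the junk quotient is harmless.\<close>
    define e where "e = a - a'"
    define y where "y = x' + (E (x - x') e / E e e) *\<^sub>R e"
    have mono: "span S \<subseteq> span (insert a S)" by (intro span_mono subset_insertI)
    have e_span: "e \<in> span (insert a S)"
      unfolding e_def using a'(1) mono by (auto intro: span_diff span_base)
    have y_span: "y \<in> span (insert a S)"
      unfolding y_def using x'(1) mono e_span by (auto intro: span_add span_scale)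
    have y_eq: "x - y = (x - x') - (E (x - x') e / E e e) *\<^sub>R e" by (simp add: y_def)
    have yS: "E (x - y) s = 0" if "s \<in> span S" for s
      using x'(2)[OF that] a'(2)[OF that]
      unfolding y_eq e_def[symmetric] linear_diff[OF E(2)] linear_cmul[OF E(2)] by simp
    have "E (x - y) e = 0"
    proof (cases "E e e = 0")
      case True
      have "e \<in> V" unfolding e_def using a a'(1) span_minimal[OF S V(1)] V(1) by (auto intro: subspace_diff)
      from definite[OF this True] show ?thesis by (simp add: linear_0[OF E(1)])
    next
      case False
      then show ?thesis
        unfolding y_eq linear_diff[OF E(2)] linear_cmul[OF E(2)] by simp
    qed
    then have "E (x - y) a = 0"
      using yS[OF a'(1)] unfolding e_def linear_diff[OF E(1)] by simp
    then have "E (x - y) s = 0" if "s \<in> insert a S" for s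
      using that yS[OF span_base] by blast
    from linear_eq_0_on_span[OF E(1) this] y_span show ?case by blast
  qed
  obtain D where D: "D \<subseteq> U" "independent D" "U \<subseteq> span D"
    by (rule real_vector.maximal_independent_subset)
  have "finite D"
    using independent_span_bound[OF V(3) D(2)] D(1) U(2) V(2) by auto
  obtain x where x: "x \<in> V" "x \<notin> U" using U(2) by blast
  obtain y where y: "y \<in> span D" "\<And>s. s \<in> span D \<Longrightarrow> E (x - y) s = 0"
    using proj[OF \<open>finite D\<close> _ x(1)] D(1) U(2) by blast
  have "y \<in> U" using y(1) D(1) U(1) span_minimal by blast
  show thesis
  proof
    show "x - y \<in> V" using x(1) \<open>y \<in> U\<close> U(2) V(1) by (auto intro: subspace_diff)
    show "x - y \<noteq> 0" using x(2) \<open>y \<in> U\<close> by auto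
    show "E (x - y) s = 0" if "s \<in> U" for s using y(2) D(3) that by blast
  qed
qed

lemma sum_fun_apply: "(\<Sum>a\<in>A. f a) x = (\<Sum>a\<in>A. f a x)"
  for f :: "'a \<Rightarrow> 'b \<Rightarrow> 'c::comm_monoid_add"
  by (induction A rule: infinite_finite_induct) simp_all

section \<open>Weyl tensors and the passage to arbitrary pairs orthogonal to a null vector\<close>

context metric
begin

lemma subspace_MC\<^sub>W: "subspace (MC\<^sub>W h)"
proof (rule subspaceI)
  have "curvature_form (\<lambda>x y z w. (0::'v list \<Rightarrow> real) [x, y, z, w])"
    by (rule curvature_form.intro) (simp_all add: linear_zero)
  then show "0 \<in> MC\<^sub>W h"
    by (simp add: MC\<^sub>W_def MC_iff fun_eq_iff \<rho>_def trace_0)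
next
  fix X Y assume XY: "X \<in> MC\<^sub>W h" "Y \<in> MC\<^sub>W h"
  then interpret X: curvature_form "\<lambda>x y z w. X [x, y, z, w]"
    by (simp add: MC\<^sub>W_def MC_iff)
  from XY interpret Y: curvature_form "\<lambda>x y z w. Y [x, y, z, w]"
    by (simp add: MC\<^sub>W_def MC_iff)
  have "curvature_form (\<lambda>x y z w. (X + Y) [x, y, z, w])"
  proof (rule curvature_form.intro)
    show "linear (\<lambda>x. (X + Y) [x, y, z, w])" for y z w
      using linear_compose_add[OF X.linear1 Y.linear1] by simp
    show "(X + Y) [y, x, z, w] = - (X + Y) [x, y, z, w]" for x y z w
      using X.skew12[of y x] Y.skew12[of y x] by simp
    show "(X + Y) [x, y, w, z] = - (X + Y) [x, y, z, w]" for x y z w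
      using X.skew34[of x y w z] Y.skew34[of x y w z] by simp
    show "(X + Y) [x, y, z, w] + (X + Y) [y, z, x, w] + (X + Y) [z, x, y, w] = 0" for x y z w
      using X.bianchi[of x y z w] Y.bianchi[of x y z w] by simp
  qed
  then show "X + Y \<in> MC\<^sub>W h" using XY
    by (simp add: MC\<^sub>W_def MC_iff fun_eq_iff \<rho>_def trace_add)
next
  fix X c assume XY: "X \<in> MC\<^sub>W h"
  then interpret X: curvature_form "\<lambda>x y z w. X [x, y, z, w]"
    by (simp add: MC\<^sub>W_def MC_iff)
  have "curvature_form (\<lambda>x y z w. (c *\<^sub>R X) [x, y, z, w])"
  proof (rule curvature_form.intro)
    show "linear (\<lambda>x. (c *\<^sub>R X) [x, y, z, w])" for y z w
      using linear_compose_scale_right[OF X.linear1] by (simp add: scaleR_fun_def)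
    show "(c *\<^sub>R X) [y, x, z, w] = - (c *\<^sub>R X) [x, y, z, w]" for x y z w
      using X.skew12[of y x] by (simp add: scaleR_fun_def)
    show "(c *\<^sub>R X) [x, y, w, z] = - (c *\<^sub>R X) [x, y, z, w]" for x y z w
      using X.skew34[of x y w z] by (simp add: scaleR_fun_def)
    show "(c *\<^sub>R X) [x, y, z, w] + (c *\<^sub>R X) [y, z, x, w] + (c *\<^sub>R X) [z, x, y, w] = 0" for x y z w
      using X.bianchi[of x y z w] by (simp add: scaleR_fun_def flip: distrib_left)
  qed
  then show "c *\<^sub>R X \<in> MC\<^sub>W h" using XY
    by (simp add: MC\<^sub>W_def MC_iff fun_eq_iff \<rho>_def trace_cmul scaleR_fun_def)
qed

text \<open>On \<open>l\<^sup>\<bottom>\<close> the form \<open>R l \<cdot> \<cdot> l\<close> is a multiple \<open>c h\<close> of \<open>h\<close>, since it vanishes on orthogonal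
  pairs; comparing traces over the whole space forces \<open>c (n - 2) = 0\<close>.\<close>

lemma null_sectional_eq_0:
  assumes R: "curvature_form R" and ricci: "\<And>x y. metric_trace h (\<lambda>p q. R p x y q) = 0"
    and dim: "dim (UNIV :: 'v set) \<noteq> 2"
    and l: "h l l = 0" "h l m = 1" "h l u = 0" "h u u \<noteq> 0"
    and orth: "\<And>a b. h l a = 0 \<Longrightarrow> h l b = 0 \<Longrightarrow> h a b = 0 \<Longrightarrow> R l a b l = 0"
    and ab: "h l a = 0" "h l b = 0"
  shows "R l a b l = 0"
proof -
  interpret curvature_form R by (rule R)
  \<comment> \<open>Chosen so that \<open>S\<close> vanishes at \<open>u\<close>,
    \<open>u\<close>.\<close>
  define c where "c = R l u u l / h u u"
  define S where "S x y = R l x y l - c * h x y" for x y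
  have S_simps: "S (x + y) z = S x z + S y z" "S z (x + y) = S z x + S z y"
    "S (x - y) z = S x z - S y z" "S z (x - y) = S z x - S z y"
    "S (r *\<^sub>R x) z = r * S x z" "S z (r *\<^sub>R x) = r * S z x" for x y z r
    by (simp_all add: S_def lin_simps algebra_simps)
  have S_sym: "S x y = S y x" for x y
    using pair_sym[of l x y l] skew12[of y l l x] skew34[of l y x l] sym[of x y] by (simp add: S_def)
  have S_orth: "S x y = 0" if "h l x = 0" "h l y = 0" "h x y = 0" for x y
    using that by (simp add: S_def orth)
  have Su: "S x u = 0" if x: "h l x = 0" for x
  proof -
    have "S (x - (h x u / h u u) *\<^sub>R u) u = 0"
      using x l by (intro S_orth) simp_all
    moreover have "S u u = 0" using l by (simp add: S_def c_def)
    ultimately show ?thesis by (simp add: S_simps)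
  qed
  have S0: "S x y = 0" if x: "h l x = 0" and y: "h l y = 0" for x y
  proof -
    \<comment> \<open>A multiple of \<open>u\<close> makes \<open>y\<close> orthogonal to
      \<open>x\<close>, and \<open>Su\<close> discards the correction.\<close>
    have *: "S x y = 0" if x: "h l x = 0" and nz: "h x u \<noteq> 0" for x
    proof -
      have "S x (y - (h x y / h x u) *\<^sub>R u) = 0"
        using x y l nz by (intro S_orth) simp_all
      then show ?thesis using Su[OF x] by (simp add: S_simps)
    qed
    show ?thesis
    proof (cases "h x u = 0")
      case True
      have "S (x + u) y = 0" using True x l by (intro *) simp_all
      moreover have "S u y = 0" using Su[OF y] S_sym by simp
      ultimately show ?thesis by (simp add: S_simps)
    qed (use * x in blast)
  qed
  \<comment> \<open>As \<open>S\<close> vanishes on the hyperplane orthogonal to \<open>l\<close>,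
    it is a symmetric product of the covector of \<open>l\<close> with some \<open>f\<close>.
    Halving \<open>S m m\<close> keeps it from being counted twice.\<close>
  define f where "f y = S m y - S m m / 2 * h l y" for y
  have lin_f: "linear f"
    by (rule linearI) (simp_all add: f_def S_simps algebra_simps)
  have S_eq: "S x y = h l x * f y + f x * h l y" for x y
  proof -
    have "S (x - h l x *\<^sub>R m) (y - h l y *\<^sub>R m) = 0"
      using l by (intro S0) simp_all
    then show ?thesis using S_sym[of x m] by (simp add: S_simps f_def algebra_simps)
  qed
  have "(\<lambda>p q. h l p * f q + f p * h l q) = (\<lambda>p q. R p l l q + - c * h p q)"
    using S_eq skew12[of l _ _ l] skew34[of _ l _ l] by (simp add: S_def fun_eq_iff)
  then have "metric_trace h (\<lambda>p q. h l p * f q + f p * h l q) = metric_trace h (\<lambda>p q. R p l l q + - c * h p q)"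
    by simp
  then have "2 * f l = - c * real (dim (UNIV :: 'v set))"
    unfolding trace_add trace_cmul trace_left[OF lin_f] trace_right[OF lin_f] trace_h ricci by simp
  moreover have "f l = - c" using l sym[of m l] by (simp add: f_def S_def)
  ultimately have "c * (real (dim (UNIV :: 'v set)) - 2) = 0" by (simp add: algebra_simps)
  with dim have "c = 0" by simp
  with S0[OF ab] show ?thesis by (simp add: S_def)
qed

lemma curvature_form_eq_0:
  assumes R: "curvature_form R" and ricci: "\<And>x y. metric_trace h (\<lambda>p q. R p x y q) = 0"
    and dim: "dim (UNIV :: 'v set) > 2"
    and frame: "h l l = 0" "h m m = 0" "h l m = 1" "h l u = 0" "h m u = 0" "h u u \<noteq> 0"
    and orth: "\<And>v a b. h v v = 0 \<Longrightarrow> h v a = 0 \<Longrightarrow> h v b = 0 \<Longrightarrow> h a b = 0 \<Longrightarrow> R v a b v = 0"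
  shows "R x y z w = 0"
proof -
  have frame': "h m l = 1" "h u l = 0" "h u m = 0" using frame sym by metis+
  have "null_frame h R l m u"
  proof (intro null_frame.intro null_frame_axioms.intro)
    show "metric h" by unfold_locales
    fix v a b
    assume v: "h v v = 0" "h v m = 1 \<or> h v l = 1" "h v a = 0" "h v b = 0"
    \<comment> \<open>The partner of \<open>v\<close> is \<open>m\<close> or \<open>l\<close>.
      Subtracting a multiple of it makes \<open>u\<close> orthogonal to \<open>v\<close> without
      changing \<open>h u u\<close>.\<close>
    obtain m' where m': "h v m' = 1" "h m' m' = 0" "h m' u = 0" "h u m' = 0"
      using v(2) frame frame' by blast
    show "R v a b v = 0"
      by (rule null_sectional_eq_0[OF R ricci, of v m' "u - h v u *\<^sub>R m'"])
        (use dim v m' orth frame in simp_all)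
  qed (use assms in auto)
  then show ?thesis by (rule null_frame.R_eq_0)
qed

end


section \<open>Duality\<close>

locale orthonormal_basis = metric h for h :: "'v::real_vector \<Rightarrow> 'v \<Rightarrow> real" +
  fixes B :: "'v set"
  assumes basis: "finite B" "independent B" "span B = UNIV"
    and orthogonal: "\<And>b c. b \<in> B \<Longrightarrow> c \<in> B \<Longrightarrow> b \<noteq> c \<Longrightarrow> h b c = 0"
    and unit: "\<And>b. b \<in> B \<Longrightarrow> h b b = 1 \<or> h b b = -1"
begin

lemma unit_square: "b \<in> B \<Longrightarrow> h b b * h b b = 1"
  using unit by force

lemma h_sum_left: "h (\<Sum>b\<in>B. f b *\<^sub>R b) c = f c * h c c" if "c \<in> B"
proof -
  have "h (\<Sum>b\<in>B. f b *\<^sub>R b) c = (\<Sum>b\<in>B. if b = c then f b * h b c else 0)"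
    unfolding linear_sum[OF linear_h(2)]
    using that by (intro sum.cong) (auto simp: orthogonal)
  then show ?thesis using that basis(1) by simp
qed

lemma h_ext: "x = y" if "\<And>c. c \<in> B \<Longrightarrow> h x c = h y c"
proof -
  have "h (x - y) z = 0" for z
    by (rule linear_eq_0_on_span[OF linear_h(1), of B]) (use that basis(3) in auto)
  from nondegenerate[OF this] show ?thesis by simp
qed

definition coord :: "'v \<Rightarrow> 'v \<Rightarrow> real" where
  "coord b x = h b b * h x b"

lemma expand: "x = (\<Sum>b\<in>B. coord b x *\<^sub>R b)"
  by (rule h_ext) (simp add: h_sum_left coord_def unit_square mult.assoc mult.left_commute)

lemma expand_linear:
  fixes f :: "'v \<Rightarrow> real"
  assumes "linear f"
  shows "f x = (\<Sum>b\<in>B. coord b x * f b)"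
  by (subst expand[of x]) (simp add: linear_sum[OF assms] linear_cmul[OF assms])

text \<open>The Cartan involution of the basis: an isometry of \<open>h\<close> that turns \<open>h\<close> into the Euclidean
  inner product for which \<open>B\<close> is orthonormal.\<close>

definition \<theta> :: "'v \<Rightarrow> 'v" where
  "\<theta> x = (\<Sum>b\<in>B. h x b *\<^sub>R b)"

lemma \<theta>_invol: "\<theta> (\<theta> x) = x"
proof -
  have "\<theta> (\<theta> x) = (\<Sum>b\<in>B. coord b x *\<^sub>R b)"
    unfolding \<theta>_def[of "\<theta> x"] by (intro sum.cong) (simp_all add: \<theta>_def h_sum_left coord_def)
  then show ?thesis using expand by simp
qed

lemma \<theta>_isometry: "h (\<theta> x) (\<theta> y) = h x y"
proof -
  have "h (\<theta> x) (\<theta> y) = (\<Sum>b\<in>B. h y b * h (\<theta> x) b)"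
    by (simp add: \<theta>_def[of y] linear_sum[OF linear_h(1)])
  also have "\<dots> = (\<Sum>b\<in>B. coord b y * h x b)"
    by (intro sum.cong) (simp_all add: \<theta>_def h_sum_left coord_def)
  also have "\<dots> = h x y" by (rule expand_linear[OF linear_h(1), symmetric])
  finally show ?thesis .
qed

lemma linear_\<theta>:
  fixes f :: "'v \<Rightarrow> real"
  assumes "linear f"
  shows "f (\<theta> x) = (\<Sum>b\<in>B. h x b * f b)"
  by (simp add: \<theta>_def linear_sum[OF assms] linear_cmul[OF assms])

definition euclidean :: "('v list \<Rightarrow> real) \<Rightarrow> ('v list \<Rightarrow> real) \<Rightarrow> real" where
  "euclidean X Y = (\<Sum>i\<in>B. \<Sum>j\<in>B. \<Sum>k\<in>B. \<Sum>l\<in>B. X [i, j, k, l] * Y [i, j, k, l])"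

lemma linear_euclidean: "linear (euclidean X)" "linear (\<lambda>X. euclidean X Y)"
  by (rule linearI; simp add: euclidean_def scaleR_fun_def sum.distrib sum_distrib_left algebra_simps)+

text \<open>The values \<open>h a i\<close> are the coordinates of \<open>\<theta> a\<close>, so
  summing over the basis evaluates \<open>F\<close> there.\<close>

lemma sum_wedge:
  assumes F: "\<And>x. linear (F x)" "\<And>y. linear (\<lambda>x. F x y)"
  shows "(\<Sum>i\<in>B. \<Sum>j\<in>B. F i j * wedge a b i j) = F (\<theta> a) (\<theta> b) - F (\<theta> b) (\<theta> a)"
proof -
  have *: "F (\<theta> a) (\<theta> b) = (\<Sum>i\<in>B. \<Sum>j\<in>B. h a i * (h b j * F i j))" for a b
  proof -
    have "F (\<theta> a) (\<theta> b) = (\<Sum>i\<in>B. h a i * F i (\<theta> b))" by (rule linear_\<theta>[OF F(2)])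
    then show ?thesis by (simp only: linear_\<theta>[OF F(1)] sum_distrib_left)
  qed
  show ?thesis
    unfolding * sum_subtractf[symmetric] by (intro sum.cong) (simp_all add: wedge_def algebra_simps)
qed

text \<open>The involution turns duality for \<open>h\<close> into Euclidean duality, so the pairing
  evaluates \<open>Y\<close>. Each skew pair contributes a factor 2, the two summands agree by
  \<open>pair_sym\<close>, and the sign is from \<open>skew34\<close>.\<close>

lemma euclidean_wedge_prod:
  assumes Y: "Y \<in> MC"
  shows "euclidean Y (wedge_prod (\<theta> v) (\<theta> a) (\<theta> b)) = - 8 * Y [v, a, b, v]"
proof -
  interpret curvature_form "\<lambda>x y z w. Y [x, y, z, w]" using Y by (simp add: MC_iff)
  have *: "(\<Sum>i\<in>B. \<Sum>j\<in>B. \<Sum>k\<in>B. \<Sum>l\<in>B. Y [i, j, k, l] * (wedge (\<theta> v) (\<theta> a) i j * wedge (\<theta> v) (\<theta> b) k l))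
      = 4 * Y [v, a, v, b]" for a b
  proof -
    have "(\<Sum>k\<in>B. \<Sum>l\<in>B. Y [i, j, k, l] * (wedge (\<theta> v) (\<theta> a) i j * wedge (\<theta> v) (\<theta> b) k l))
      = 2 * Y [i, j, v, b] * wedge (\<theta> v) (\<theta> a) i j" for i j
    proof -
      have "(\<Sum>k\<in>B. \<Sum>l\<in>B. Y [i, j, k, l] * (wedge (\<theta> v) (\<theta> a) i j * wedge (\<theta> v) (\<theta> b) k l))
        = wedge (\<theta> v) (\<theta> a) i j * (\<Sum>k\<in>B. \<Sum>l\<in>B. Y [i, j, k, l] * wedge (\<theta> v) (\<theta> b) k l)"
        by (simp only: sum_distrib_left mult.left_commute)
      then show ?thesis
        using skew34[of i j b v] by (simp add: sum_wedge[OF linear4 linear3] \<theta>_invol)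
    qed
    moreover have "(\<Sum>i\<in>B. \<Sum>j\<in>B. 2 * Y [i, j, v, b] * wedge (\<theta> v) (\<theta> a) i j)
        = 2 * (\<Sum>i\<in>B. \<Sum>j\<in>B. Y [i, j, v, b] * wedge (\<theta> v) (\<theta> a) i j)"
      by (simp only: sum_distrib_left mult.assoc)
    ultimately show ?thesis
      using skew12[of a v v b] by (simp add: sum_wedge[OF linear2 linear1] \<theta>_invol)
  qed
  have "Y [v, b, v, a] = Y [v, a, v, b]" using pair_sym .
  moreover have "Y [v, a, v, b] = - Y [v, a, b, v]" using skew34 .
  ultimately show ?thesis
    by (simp add: euclidean_def distrib_left sum.distrib *)
qed

text \<open>These need not lie in \<open>MC\<close>; they provide a finite set whose span contains
  it.\<close>

definition basis_tensor :: "'v \<Rightarrow> 'v \<Rightarrow> 'v \<Rightarrow> 'v \<Rightarrow> 'v list \<Rightarrow> real" where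
  "basis_tensor i j k l vs = (if length vs = 4
     then coord i (vs ! 0) * (coord j (vs ! 1) * (coord k (vs ! 2) * coord l (vs ! 3))) else 0)"

lemma expand_MC:
  assumes "Y \<in> MC"
  shows "Y = (\<Sum>i\<in>B. \<Sum>j\<in>B. \<Sum>k\<in>B. \<Sum>l\<in>B. Y [i, j, k, l] *\<^sub>R basis_tensor i j k l)"
proof
  fix vs
  interpret curvature_form "\<lambda>x y z w. Y [x, y, z, w]" using assms by (simp add: MC_iff)
  show "Y vs = (\<Sum>i\<in>B. \<Sum>j\<in>B. \<Sum>k\<in>B. \<Sum>l\<in>B. Y [i, j, k, l] *\<^sub>R basis_tensor i j k l) vs"
  proof (cases "length vs = 4")
    case True
    then obtain x y z w where vs: "vs = [x, y, z, w]" by (rule length_4E)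
    have "Y [x, y, z, w] = (\<Sum>i\<in>B. coord i x * (\<Sum>j\<in>B. coord j y * (\<Sum>k\<in>B. coord k z *
        (\<Sum>l\<in>B. coord l w * Y [i, j, k, l]))))"
      unfolding expand_linear[OF linear4, of _ _ _ w, symmetric] expand_linear[OF linear3, of _ _ z, symmetric]
        expand_linear[OF linear2, of _ y, symmetric] expand_linear[OF linear1, of x, symmetric] ..
    then show ?thesis
      by (simp add: vs sum_fun_apply scaleR_fun_def basis_tensor_def sum_distrib_left mult_ac)
  next
    case False
    then show ?thesis using assms
      by (simp add: MC_iff sum_fun_apply scaleR_fun_def basis_tensor_def)
  qed
qed

lemma euclidean_definite:
  assumes "Y \<in> MC" "euclidean Y Y = 0"
  shows "Y = 0"
proof -
  have "Y [i, j, k, l] = 0" if "i \<in> B" "j \<in> B" "k \<in> B" "l \<in> B" for i j k l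
  proof -
    have "\<forall>i\<in>B. \<forall>j\<in>B. \<forall>k\<in>B. \<forall>l\<in>B. Y [i, j, k, l] * Y [i, j, k, l] = 0"
      using assms(2) basis(1) by (simp add: euclidean_def sum_nonneg_eq_0_iff sum_nonneg)
    with that show ?thesis by auto
  qed
  then show ?thesis by (subst expand_MC[OF assms(1)]) simp
qed

lemma span_square_zero:
  assumes dim: "dim (UNIV :: 'v set) > 2"
    and frame: "h l l = 0" "h m m = 0" "h l m = 1" "h l u = 0" "h m u = 0" "h u u \<noteq> 0"
  shows "span {X \<in> MC\<^sub>W h. square_zero h X} = MC\<^sub>W h"
proof (rule ccontr)
  let ?U = "span {X \<in> MC\<^sub>W h. square_zero h X}"
  let ?T = "(\<lambda>(i, j, k, l). basis_tensor i j k l) ` (B \<times> B \<times> B \<times> B)"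
  assume "?U \<noteq> MC\<^sub>W h"
  moreover have "?U \<subseteq> MC\<^sub>W h" by (rule span_minimal[OF _ subspace_MC\<^sub>W]) auto
  ultimately have U: "?U \<subset> MC\<^sub>W h" by blast
  have span: "MC\<^sub>W h \<subseteq> span ?T"
  proof
    fix Y assume "Y \<in> MC\<^sub>W h"
    then have "Y \<in> MC" by (simp add: MC\<^sub>W_def)
    show "Y \<in> span ?T"
      by (subst expand_MC[OF \<open>Y \<in> MC\<close>]) (force intro: span_sum span_scale span_base)
  qed
  have fin: "finite ?T" using basis(1) by simp
  have definite: "X = 0" if "X \<in> MC\<^sub>W h" "euclidean X X = 0" for X
    using euclidean_definite that by (simp add: MC\<^sub>W_def)
  obtain Z where Z: "Z \<in> MC\<^sub>W h" "Z \<noteq> 0" and ortho: "\<And>X. X \<in> ?U \<Longrightarrow> euclidean Z X = 0"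
    by (rule ex_orthogonal_complement_vector
        [OF linear_euclidean subspace_span U subspace_MC\<^sub>W span fin]) (blast intro: definite that)+
  have Z_MC: "Z \<in> MC" and ricci: "metric_trace h (\<lambda>p q. Z [p, x, y, q]) = 0" for x y
    using Z(1) by (auto simp: MC\<^sub>W_def \<rho>_def fun_eq_iff)
  have cf: "curvature_form (\<lambda>x y z w. Z [x, y, z, w])" using Z_MC by (simp add: MC_iff)
  have "Z [v, a, b, v] = 0" if "h v v = 0" "h v a = 0" "h v b = 0" "h a b = 0" for v a b
  proof -
    \<comment> \<open>An isometry preserves the relations among \<open>v\<close>, \<open>a\<close>,
      \<open>b\<close>, so this product is a square-zero element to which \<open>Z\<close> is
      orthogonal.\<close>
    have "wedge_prod (\<theta> v) (\<theta> a) (\<theta> b) \<in> ?U"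
      using that by (intro span_base CollectI conjI wedge_prod_in_MC\<^sub>W)
        (simp_all add: \<theta>_isometry square_zero_def mc_mult_wedge_prod)
    from ortho[OF this] show ?thesis by (simp add: euclidean_wedge_prod[OF Z_MC])
  qed
  then have Z0: "Z [x, y, z, w] = 0" for x y z w
    by (rule curvature_form_eq_0[OF cf ricci dim frame])
  have "Z vs = 0" for vs
  proof (cases "length vs = 4")
    case True
    then show ?thesis by (rule length_4E) (simp only: Z0)
  next
    case False
    then show ?thesis using Z_MC unfolding MC_iff by blast
  qed
  then have "Z = 0" by (simp add: fun_eq_iff)
  with Z(2) show False by contradiction
qed

end

section \<open>Trivial subalgebras and the choice of the frame\<close>

lemma (in metric) trivial_subalgebra_wedge_prod:
  assumes frame: "h l l = 0" "h l m = 1" "h l u = 0" "h m u = 0" "h u u \<noteq> 0"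
    and D: "independent D" "\<And>d. d \<in> D \<Longrightarrow> h l d = 0 \<and> h m d = 0 \<and> h u d = 0"
  shows "trivial_subalgebra h (wedge_prod l u ` span D)" "dim (wedge_prod l u ` span D) = card D"
proof -
  have spanD: "h l d = 0" "h m d = 0" "h u d = 0" if "d \<in> span D" for d
    using that by (auto intro: linear_eq_0_on_span[OF linear_h(1), of D] simp: D(2))
  have lin: "linear (wedge_prod l u)"
    by (rule linearI) (auto simp: fun_eq_iff wedge_prod_def wedge_def scaleR_fun_def algebra_simps)
  show "trivial_subalgebra h (wedge_prod l u ` span D)"
    unfolding trivial_subalgebra_def
    using frame spanD
    by (auto intro!: linear_subspace_image[OF lin subspace_span] wedge_prod_in_MC\<^sub>W mc_mult_wedge_prod)
  have inj: "inj_on (wedge_prod l u) (span D)"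
  proof (rule inj_onI)
    fix x y assume x: "x \<in> span D" and y: "y \<in> span D" and eq: "wedge_prod l u x = wedge_prod l u y"
    \<comment> \<open>This evaluation recovers \<open>h d z\<close> up to the nonzero factor
      \<open>- h u u\<close>, whence injectivity.\<close>
    have eval: "wedge_prod l u d [m, u, z, m] = - h u u * h d z" if "d \<in> span D" for d z
      using spanD[OF that] frame sym[of d m] sym[of d u] sym[of u m] by (simp add: wedge_def)
    have "h (x - y) z = 0" for z
      using fun_cong[OF eq, of "[m, u, z, m]"] eval[OF x, of z] eval[OF y, of z] frame by simp
    from nondegenerate[OF this] show "x = y" by simp
  qed
  have "dim (wedge_prod l u ` span D) = card (wedge_prod l u ` D)"
    unfolding linear_span_image[OF lin, symmetric]
    by (intro dim_span_eq_card_independent linear_independent_injective_image lin D(1) inj)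
  also have "\<dots> = card D"
    by (rule card_image[OF inj_on_subset[OF inj span_superset]])
  finally show "dim (wedge_prod l u ` span D) = card D" .
qed

theorem lemma7p3:
  fixes h :: "'v::real_vector \<Rightarrow> 'v \<Rightarrow> real" and n k p q :: nat
  assumes "metric_vector_space h"
    and "dim (UNIV :: 'v set) = n" and "n > 3"
    and "has_signature h p q" and "k = min p q" and "k \<ge> 1"
  shows "span {X \<in> MC\<^sub>W h. square_zero h X} = MC\<^sub>W h \<and>
         (\<exists>S. trivial_subalgebra h S \<and> dim S = n - 2 * k - 1)"
proof -
  obtain B where B: "finite B" "independent B" "span B = UNIV"
    "\<And>b c. b \<in> B \<Longrightarrow> c \<in> B \<Longrightarrow> b \<noteq> c \<Longrightarrow> h b c = 0" "\<And>b. b \<in> B \<Longrightarrow> h b b = 1 \<or> h b b = -1"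
    "card {b\<in>B. h b b = 1} = p" "card {b\<in>B. h b b = -1} = q"
    using assms(4) unfolding has_signature_def by blast
  interpret orthonormal_basis h B
    using assms(1) B by unfold_locales auto
  have "card B = n"
    using dim_span_eq_card_independent[OF B(2)] B(3) assms(2) by simp
  \<comment> \<open>Since \<open>k\<close> is at least 1, both signs occur in the basis.\<close>
  have "{b\<in>B. h b b = 1} \<noteq> {}" "{b\<in>B. h b b = -1} \<noteq> {}"
    using B(6,7) assms(5,6) by (metis card.empty min.bounded_iff not_one_le_zero)+
  then obtain e f where e: "e \<in> B" "h e e = 1" and f: "f \<in> B" "h f f = -1" by blast
  then have "e \<noteq> f" by auto
  then have ef: "h e f = 0" "h f e = 0" using e f B(4) by auto
  have "card (B - {e, f}) = n - 2"
    using \<open>card B = n\<close> e f \<open>e \<noteq> f\<close> B(1) by (simp add: card_Diff_subset)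
  with assms(3) have "B - {e, f} \<noteq> {}" by force
  then obtain u where u: "u \<in> B" "u \<noteq> e" "u \<noteq> f" by blast
  \<comment> \<open>The sum and half the difference of a positive and a negative unit vector form a
    hyperbolic pair.\<close>
  define l m where "l = e + f" and "m = (1/2) *\<^sub>R (e - f)"
  have orth: "h l d = 0" "h m d = 0" if "d \<in> B" "d \<noteq> e" "d \<noteq> f" for d
    using that e f B(4) by (simp_all add: l_def m_def)
  have frame: "h l l = 0" "h m m = 0" "h l m = 1" "h l u = 0" "h m u = 0" "h u u \<noteq> 0"
    using e f ef orth[OF u] B(5)[OF u(1)] by (auto simp: l_def m_def)
  have "card (B - {e, f, u}) = n - 3"
    using \<open>card B = n\<close> e f u \<open>e \<noteq> f\<close> B(1) by (simp add: card_Diff_subset)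
  \<comment> \<open>As \<open>k\<close> is at least 1, the \<open>n - 3\<close> remaining basis
    vectors suffice. For \<open>n = 2 * k\<close> the truncated subtraction gives 0, and the
    subalgebra is zero.\<close>
  then have "n - 2 * k - 1 \<le> card (B - {e, f, u})" using assms(6) by simp
  then obtain D where D: "D \<subseteq> B - {e, f, u}" "card D = n - 2 * k - 1"
    by (rule obtain_subset_with_card_n)
  have "independent D" using D(1) B(2) independent_mono by blast
  moreover have "h l d = 0 \<and> h m d = 0 \<and> h u d = 0" if "d \<in> D" for d
    using that D(1) orth[of d] B(4)[OF u(1), of d] by blast
  ultimately have "\<exists>S. trivial_subalgebra h S \<and> dim S = n - 2 * k - 1"
    using trivial_subalgebra_wedge_prod[OF frame(1,3-6)] D(2) by metis
  moreover have "span {X \<in> MC\<^sub>W h. square_zero h X} = MC\<^sub>W h"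
    by (rule span_square_zero[OF _ frame]) (use assms(2,3) in simp)
  ultimately show ?thesis by simp
qed

end
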